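(* Let $((s_j,t_j):-\infty<j<\infty)$ be a two-sided sequence of pairs of positive random variables. Put $\widetilde T_n=\sum_{k=1}^n t_{-k}$ for $n\ge 0$, $\bar F(x)=\mathbf P(s_1>x)$, and $$\widetilde X_\infty=\max\Big(0,\ \sup_{j\ge 1}\big[s_{-j}-\widetilde T_{j-1}\big]\Big)\in[0,\infty].$$ Consider the following two assumptions. (A1) $((s_j,t_j):-\infty<j<\infty)$ is a stationary ergodic sequence. (A2) $(s_j:-\infty<j<\infty)$ is an independent and identically distributed sequence, independent of the sequence $(t_j:-\infty<j<\infty)$, and $(t_j:-\infty<j<\infty)$ is stationary and ergodic. Then: a) If (A1) holds, $\mathbf E\,t_1<\infty$ and $\mathbf E\,s_1<\infty$, then $\widetilde X_\infty$ is finite-valued almost surely. b) If (A2) holds, $\mathbf E\,t_1<\infty$, and $\widetilde X_\infty$ is finite-valued almost surely, then $\mathbf E\,s_1<\infty$. c) If (A2) holds, then $\widetilde X_\infty$ is finite-valued almost surely if and only if $\mathbf P\big(\sum_{k=1}^\infty\bar F(\widetilde T_k)<\infty\big)=1$.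
   Context: Empty sums are $0$, so $\widetilde T_0=0$. Positive random variables are finite and strictly positive. *)

theory Defs
  imports "HOL-Probability.Probability"
begin

definition shift_seq :: "(int \<Rightarrow> 'b) \<Rightarrow> int \<Rightarrow> 'b" where
  "shift_seq x = (\<lambda>j. x (j + 1))"

definition path_law ::
  "'a measure \<Rightarrow> (int \<Rightarrow> 'a \<Rightarrow> 'b::topological_space) \<Rightarrow> (int \<Rightarrow> 'b) measure" where
  "path_law M Z = distr M (\<Pi>\<^sub>M j\<in>UNIV. borel) (\<lambda>\<omega> j. Z j \<omega>)"

definition stationary_seq :: "'a measure \<Rightarrow> (int \<Rightarrow> 'a \<Rightarrow> 'b::topological_space) \<Rightarrow> bool" where
  "stationary_seq M Z \<longleftrightarrow>
     (\<forall>j. Z j \<in> borel_measurable M) \<and>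
     distr (path_law M Z) (\<Pi>\<^sub>M j\<in>UNIV. borel) shift_seq = path_law M Z"

(* The space of the path law is all of int => 'b, so no intersection with it is needed in
   the condition of shift-invariance. Meaningful in combination with stationarity. *)
definition ergodic_seq :: "'a measure \<Rightarrow> (int \<Rightarrow> 'a \<Rightarrow> 'b::topological_space) \<Rightarrow> bool" where
  "ergodic_seq M Z \<longleftrightarrow>
     (\<forall>A \<in> sets (path_law M Z). shift_seq -` A = A \<longrightarrow> measure (path_law M Z) A \<in> {0, 1})"

definition iid_seq :: "'a measure \<Rightarrow> (int \<Rightarrow> 'a \<Rightarrow> 'b::topological_space) \<Rightarrow> bool" where
  "iid_seq M Z \<longleftrightarrow>
     prob_space.indep_vars M (\<lambda>_. borel) Z UNIV \<and>
     (\<forall>i j. distr M borel (Z i) = distr M borel (Z j))"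

definition assumption_A1 ::
  "'a measure \<Rightarrow> (int \<Rightarrow> 'a \<Rightarrow> real) \<Rightarrow> (int \<Rightarrow> 'a \<Rightarrow> real) \<Rightarrow> bool" where
  "assumption_A1 M s t \<longleftrightarrow>
     stationary_seq M (\<lambda>j \<omega>. (s j \<omega>, t j \<omega>)) \<and> ergodic_seq M (\<lambda>j \<omega>. (s j \<omega>, t j \<omega>))"

definition assumption_A2 ::
  "'a measure \<Rightarrow> (int \<Rightarrow> 'a \<Rightarrow> real) \<Rightarrow> (int \<Rightarrow> 'a \<Rightarrow> real) \<Rightarrow> bool" where
  "assumption_A2 M s t \<longleftrightarrow>
     iid_seq M s \<and>
     prob_space.indep_var M
       (\<Pi>\<^sub>M j\<in>UNIV. borel) (\<lambda>\<omega> j. s j \<omega>) (\<Pi>\<^sub>M j\<in>UNIV. borel) (\<lambda>\<omega> j. t j \<omega>) \<and>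
     stationary_seq M t \<and> ergodic_seq M t"

definition T_tilde :: "(int \<Rightarrow> 'a \<Rightarrow> real) \<Rightarrow> nat \<Rightarrow> 'a \<Rightarrow> real" where
  "T_tilde t n \<omega> = (\<Sum>k=1..n. t (- int k) \<omega>)"

(* Nonnegative by construction, so finite-valued means smaller than infinity. *)
definition X_tilde_inf :: "(int \<Rightarrow> 'a \<Rightarrow> real) \<Rightarrow> (int \<Rightarrow> 'a \<Rightarrow> real) \<Rightarrow> 'a \<Rightarrow> ereal" where
  "X_tilde_inf s t \<omega> =
     max 0 (SUP j\<in>{1::nat..}. ereal (s (- int j) \<omega> - T_tilde t (j - 1) \<omega>))"

definition tail_prob :: "'a measure \<Rightarrow> ('a \<Rightarrow> real) \<Rightarrow> real \<Rightarrow> real" where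
  "tail_prob M Y x = \<P>(\<omega> in M. Y \<omega> > x)"

end

theory Submission
  imports Defs
begin

text \<open>
  Only a weak form of the ergodic theorem is needed: if \<open>E f < 0\<close>, then the partial sums of \<open>f\<close>
  along the past of a stationary ergodic sequence are almost surely bounded above. Indeed
  unboundedness is a shift-invariant event, and if it had probability 1, then Garsia's maximal
  argument would give \<open>E f \<ge> 0\<close>. Applied to \<open>E (min 1 t) / 2 - min 1 t\<close> and to \<open>t - C\<close>, this
  bounds \<open>T\<^sub>n\<close> from below and from above by linear functions of \<open>n\<close>.

  Part a) follows by Borel--Cantelli. For part c), freeze \<open>t\<close> by Fubini: if \<open>\<Sum>\<^sub>n F (T\<^sub>n) < \<infinity>\<close>
  for the tail function \<open>F\<close>, Borel--Cantelli applies again, and conversely independence of the \<open>s\<^sub>j\<close>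
  yields \<open>\<Sum>\<^sub>n F (T\<^sub>n + K) < \<infinity>\<close> for some random \<open>K\<close>, which is removed using stationarity and
  \<open>T\<^sub>n \<rightarrow> \<infinity>\<close>. Part b) combines c) with the linear upper bound on \<open>T\<^sub>n\<close>.
\<close>

subsection \<open>Sums along the past\<close>

text \<open>Defined on paths rather than on the sample space, so that the shift and the path law act
  on it; coordinate 0 stays outside the sum, as in \<open>T_tilde\<close>.\<close>

definition back_sum :: "('b \<Rightarrow> real) \<Rightarrow> nat \<Rightarrow> (int \<Rightarrow> 'b) \<Rightarrow> real" where
  "back_sum f n x = (\<Sum>k=1..n. f (x (- int k)))"

lemma back_sum_0 [simp]: "back_sum f 0 x = 0"
  by (simp add: back_sum_def)

lemma back_sum_Suc: "back_sum f (Suc n) x = back_sum f n x + f (x (- int (Suc n)))"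
  by (simp add: back_sum_def)

text \<open>After one shift the old coordinate 0 sits at position -1 and becomes the first
  summand.\<close>

lemma back_sum_shift: "back_sum f (Suc n) (shift_seq x) = f (x 0) + back_sum f n x"
proof (induction n)
  case 0
  then show ?case by (simp add: back_sum_Suc shift_seq_def)
next
  case (Suc n)
  have "shift_seq x (- int (Suc (Suc n))) = x (- int (Suc n))"
    by (simp add: shift_seq_def)
  with Suc show ?case by (simp only: back_sum_Suc)
qed

lemma measurable_shift_seq [measurable]:
  "shift_seq \<in> (\<Pi>\<^sub>M j\<in>UNIV. borel) \<rightarrow>\<^sub>M (\<Pi>\<^sub>M j\<in>UNIV. (borel :: 'b::topological_space measure))"
  unfolding shift_seq_def by (rule measurable_PiM_single') auto

lemma measurable_back_sum [measurable]:
  fixes f :: "'b::topological_space \<Rightarrow> real"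
  assumes [measurable]: "f \<in> borel_measurable borel"
  shows "back_sum f n \<in> borel_measurable (\<Pi>\<^sub>M j\<in>UNIV. borel)"
  unfolding back_sum_def by measurable

text \<open>The starting value 0 is the empty sum; it keeps the maximum nonnegative and yields the
  recursion \<open>back_max_shift\<close>.\<close>

primrec back_max :: "('b \<Rightarrow> real) \<Rightarrow> nat \<Rightarrow> (int \<Rightarrow> 'b) \<Rightarrow> real" where
  "back_max f 0 x = 0"
| "back_max f (Suc n) x = max (back_max f n x) (back_sum f (Suc n) x)"

lemma back_max_0: "back_max f 0 = (\<lambda>x. 0)"
  by auto

lemma back_max_Suc: "back_max f (Suc n) = (\<lambda>x. max (back_max f n x) (back_sum f (Suc n) x))"
  by auto

lemma back_max_nonneg: "0 \<le> back_max f n x"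
  by (induction n) auto

lemma back_max_mono: "m \<le> n \<Longrightarrow> back_max f m x \<le> back_max f n x"
  by (induction rule: dec_induct) auto

lemma back_sum_le_back_max: "back_sum f n x \<le> back_max f n x"
  by (cases n) auto

text \<open>Lindley's recursion: each nonempty sum of the shifted path is \<open>f (x 0)\<close>
  plus a sum of \<open>x\<close> with one term fewer, and the 0 is the empty sum.\<close>

lemma back_max_shift: "back_max f (Suc n) (shift_seq x) = max 0 (f (x 0) + back_max f n x)"
proof (induction n)
  case 0
  show ?case by (simp add: back_sum_shift)
next
  case (Suc n)
  show ?case
    by (subst back_max.simps(2), subst Suc, subst back_sum_shift) simp
qed

lemma measurable_back_max [measurable]:
  fixes f :: "'b::topological_space \<Rightarrow> real"
  assumes [measurable]: "f \<in> borel_measurable borel"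
  shows "back_max f n \<in> borel_measurable (\<Pi>\<^sub>M j\<in>UNIV. borel)"
proof (induction n)
  case 0
  show ?case by (simp only: back_max_0) simp
next
  case (Suc n)
  note [measurable] = Suc
  show ?case by (simp only: back_max_Suc) measurable
qed

text \<open>The shift changes the sums by one finite term and one index. This makes boundedness an
  exactly shift-invariant event, as \<open>ergodic_seq\<close> demands.\<close>

lemma bdd_above_back_sum_shift:
  "bdd_above (range (\<lambda>n. back_sum f n (shift_seq x))) \<longleftrightarrow> bdd_above (range (\<lambda>n. back_sum f n x))"
proof
  assume "bdd_above (range (\<lambda>n. back_sum f n (shift_seq x)))"
  then obtain K where K: "\<And>n. back_sum f n (shift_seq x) \<le> K"
    by (auto simp: bdd_above_def)
  have "back_sum f n x \<le> K - f (x 0)" for n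
    using K[of "Suc n"] by (simp add: back_sum_shift)
  then show "bdd_above (range (\<lambda>n. back_sum f n x))"
    by (intro bdd_aboveI2)
next
  assume "bdd_above (range (\<lambda>n. back_sum f n x))"
  then obtain K where K: "\<And>n. back_sum f n x \<le> K"
    by (auto simp: bdd_above_def)
  have "back_sum f n (shift_seq x) \<le> max 0 (K + f (x 0))" for n
  proof (cases n)
    case (Suc m)
    then show ?thesis using K[of m] by (simp add: back_sum_shift)
  qed simp
  then show "bdd_above (range (\<lambda>n. back_sum f n (shift_seq x)))"
    by (intro bdd_aboveI2)
qed

text \<open>Real bounds can be replaced by natural ones, which leaves only countable
  quantifiers.\<close>

lemma pred_bdd_above_range [measurable]:
  fixes X :: "nat \<Rightarrow> 'a \<Rightarrow> real"
  assumes [measurable]: "\<And>n. X n \<in> borel_measurable M"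
  shows "Measurable.pred M (\<lambda>x. bdd_above (range (\<lambda>n. X n x)))"
proof -
  have "bdd_above (range (\<lambda>n. X n x)) \<longleftrightarrow> (\<exists>K::nat. \<forall>n. X n x \<le> real K)" for x
  proof
    assume "bdd_above (range (\<lambda>n. X n x))"
    then obtain B where B: "\<And>n. X n x \<le> B"
      by (auto simp: bdd_above_def)
    obtain K where "B \<le> real K"
      using real_arch_simple by blast
    with B show "\<exists>K::nat. \<forall>n. X n x \<le> real K"
      by (meson order_trans)
  qed (auto intro: bdd_aboveI2)
  then show ?thesis by simp
qed

subsection \<open>Stationary and ergodic processes\<close>

locale stationary_process = prob_space M
  for M :: "'a measure" and Z :: "int \<Rightarrow> 'a \<Rightarrow> 'b::topological_space" +
  assumes stationary: "stationary_seq M Z"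
begin

abbreviation Q :: "(int \<Rightarrow> 'b) measure" where
  "Q \<equiv> path_law M Z"

lemma measurable_coord [measurable]: "Z j \<in> borel_measurable M"
  using stationary by (simp add: stationary_seq_def)

lemma measurable_path [measurable]: "(\<lambda>\<omega> j. Z j \<omega>) \<in> M \<rightarrow>\<^sub>M (\<Pi>\<^sub>M j\<in>UNIV. borel)"
  by (rule measurable_PiM_single') auto

lemma sets_path_law [measurable_cong]: "sets Q = sets (\<Pi>\<^sub>M j\<in>UNIV. borel)"
  by (simp add: path_law_def)

lemma space_path_law [simp]: "space Q = UNIV"
  by (simp add: path_law_def space_PiM PiE_def)

lemma prob_space_path_law: "prob_space Q"
  unfolding path_law_def by (rule prob_space_distr) measurable

lemma distr_shift: "distr Q Q shift_seq = Q"
proof -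
  have "distr Q Q shift_seq = distr Q (\<Pi>\<^sub>M j\<in>UNIV. borel) shift_seq"
    by (rule distr_cong) (simp_all add: sets_path_law)
  then show ?thesis using stationary by (simp add: stationary_seq_def)
qed

lemma integrable_shift_iff:
  fixes g :: "(int \<Rightarrow> 'b) \<Rightarrow> real"
  assumes [measurable]: "g \<in> borel_measurable (\<Pi>\<^sub>M j\<in>UNIV. borel)"
  shows "integrable Q (\<lambda>x. g (shift_seq x)) \<longleftrightarrow> integrable Q g"
  by (subst (2) distr_shift[symmetric], subst integrable_distr_eq) auto

lemma integral_shift:
  fixes g :: "(int \<Rightarrow> 'b) \<Rightarrow> real"
  assumes [measurable]: "g \<in> borel_measurable (\<Pi>\<^sub>M j\<in>UNIV. borel)"
  shows "(\<integral>x. g (shift_seq x) \<partial>Q) = (\<integral>x. g x \<partial>Q)"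
  by (subst (2) distr_shift[symmetric], subst integral_distr) auto

lemma pred_setsD:
  assumes "Measurable.pred (\<Pi>\<^sub>M j\<in>UNIV. borel) P"
  shows "{x. P x} \<in> sets Q"
  using assms by (simp add: pred_def sets_path_law space_PiM PiE_def)

lemma measure_shift:
  assumes [measurable]: "Measurable.pred (\<Pi>\<^sub>M j\<in>UNIV. borel) P"
  shows "measure Q {x. P (shift_seq x)} = measure Q {x. P x}"
proof -
  show ?thesis
    using pred_setsD[OF assms]
    by (subst (2) distr_shift[symmetric], subst measure_distr) (auto simp: vimage_def)
qed

lemma AE_path_law:
  assumes "Measurable.pred (\<Pi>\<^sub>M j\<in>UNIV. borel) P"
  shows "(AE x in Q. P x) \<longleftrightarrow> (AE \<omega> in M. P (\<lambda>j. Z j \<omega>))"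
  unfolding path_law_def using assms by (subst AE_distr_iff) (auto simp: pred_def)

lemma distr_shift_coord: "distr M borel (Z (j + 1)) = distr M borel (Z j)"
proof -
  have coord: "distr M borel (Z j) = distr Q borel (\<lambda>x. x j)" for j
    unfolding path_law_def by (subst distr_distr) (auto simp: comp_def)
  have "distr Q borel (\<lambda>x. x j) = distr Q borel (\<lambda>x. shift_seq x j)"
    by (subst distr_shift[symmetric], subst distr_distr) (auto simp: comp_def)
  then show ?thesis by (simp only: coord shift_seq_def)
qed

lemma distr_coord: "distr M borel (Z j) = distr M borel (Z 0)"
proof (induction j rule: int_induct[where k = 0])
  case (step1 i)
  then show ?case by (simp add: distr_shift_coord)
next
  case (step2 i)
  then show ?case using distr_shift_coord[of "i - 1"] by simp
qed simp

text \<open>By \<open>back_max_shift\<close> the shifted maximum is integrable once the previous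
  maximum is; stationarity then removes the shift.\<close>

lemma integrable_back_max:
  fixes f :: "'b \<Rightarrow> real"
  assumes [measurable]: "f \<in> borel_measurable borel" and int: "integrable Q (\<lambda>x. f (x 0))"
  shows "integrable Q (back_max f n)"
proof (induction n)
  case 0
  show ?case by (simp only: back_max_0) simp
next
  case (Suc n)
  then have "integrable Q (\<lambda>x. max 0 (f (x 0) + back_max f n x))"
    using int by (intro integrable_max) auto
  then have "integrable Q (\<lambda>x. back_max f (Suc n) (shift_seq x))"
    by (simp only: back_max_shift)
  then show ?case
    by (subst (asm) integrable_shift_iff) (simp_all del: back_max.simps)
qed

text \<open>Garsia's argument: writing \<open>M\<^sub>n\<close> for \<open>back_max f n\<close>, stationarity gives
  \<open>0 \<le> E (M\<^bsub>n+1\<^esub> \<circ> shift - M\<^sub>n) = E (max (f (x\<^sub>0)) (- M\<^sub>n))\<close>, and the right-hand side tends to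
  \<open>E (f (x\<^sub>0))\<close> if \<open>M\<^sub>n \<longrightarrow> \<infinity>\<close> almost surely.\<close>

lemma unbounded_back_sum_imp_integral_nonneg:
  fixes f :: "'b \<Rightarrow> real"
  assumes [measurable]: "f \<in> borel_measurable borel" and int: "integrable Q (\<lambda>x. f (x 0))"
    and unbdd: "AE x in Q. \<not> bdd_above (range (\<lambda>n. back_sum f n x))"
  shows "0 \<le> (\<integral>x. f (x 0) \<partial>Q)"
proof -
  have nonneg: "0 \<le> (\<integral>x. max (f (x 0)) (- back_max f n x) \<partial>Q)" for n
  proof -
    have int': "integrable Q (\<lambda>x. back_max f (Suc n) (shift_seq x))"
      by (subst integrable_shift_iff) (auto intro: integrable_back_max int)
    have "(\<integral>x. back_max f n x \<partial>Q) \<le> (\<integral>x. back_max f (Suc n) x \<partial>Q)"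
      by (intro integral_mono integrable_back_max int back_max_mono) auto
    also have "\<dots> = (\<integral>x. back_max f (Suc n) (shift_seq x) \<partial>Q)"
      by (rule integral_shift[symmetric]) measurable
    finally have "0 \<le> (\<integral>x. back_max f (Suc n) (shift_seq x) - back_max f n x \<partial>Q)"
      using int' by (subst Bochner_Integration.integral_diff) (auto intro: integrable_back_max int)
    also have "(\<lambda>x. back_max f (Suc n) (shift_seq x) - back_max f n x)
        = (\<lambda>x. max (f (x 0)) (- back_max f n x))"
      unfolding back_max_shift by (auto simp: fun_eq_iff max_def)
    finally show ?thesis .
  qed
  have lim: "(\<lambda>n. \<integral>x. max (f (x 0)) (- back_max f n x) \<partial>Q) \<longlonglongrightarrow> (\<integral>x. f (x 0) \<partial>Q)"
  proof (rule integral_dominated_convergence[where w = "\<lambda>x. \<bar>f (x 0)\<bar>"])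
    show "AE x in Q. (\<lambda>n. max (f (x 0)) (- back_max f n x)) \<longlonglongrightarrow> f (x 0)"
      using unbdd
    proof eventually_elim
      case (elim x)
      \<comment> \<open>From such an \<open>m\<close> on, the truncation at
        \<open>- back_max f n x\<close> is inactive, so the sequence is eventually constant.\<close>
      then obtain m where m: "back_sum f m x > - f (x 0)"
        by (meson bdd_aboveI2 not_le)
      have "max (f (x 0)) (- back_max f n x) = f (x 0)" if "n \<ge> m" for n
        using m back_sum_le_back_max[of f m x] back_max_mono[OF that, of f x] by simp
      then show ?case
        by (intro tendsto_eventually eventually_sequentiallyI)
    qed
    \<comment> \<open>The truncation level is at most 0, so it only moves negative values towards
      0.\<close>
    show "AE x in Q. norm (max (f (x 0)) (- back_max f n x)) \<le> \<bar>f (x 0)\<bar>" for n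
      using back_max_nonneg[of f n] by (intro AE_I2) (auto simp: max_def abs_if; smt (verit))
  qed (use int in auto)
  show ?thesis
    using nonneg by (intro LIMSEQ_le_const[OF lim]) auto
qed

lemma integrable_coord_path_law:
  fixes f :: "'b \<Rightarrow> real"
  assumes [measurable]: "f \<in> borel_measurable borel"
  shows "integrable Q (\<lambda>x. f (x j)) \<longleftrightarrow> integrable M (\<lambda>\<omega>. f (Z j \<omega>))"
    and "(\<integral>x. f (x j) \<partial>Q) = (\<integral>\<omega>. f (Z j \<omega>) \<partial>M)"
proof -
  have [measurable]: "(\<lambda>x. f (x j)) \<in> borel_measurable (\<Pi>\<^sub>M j\<in>UNIV. borel)"
    by measurable
  show "integrable Q (\<lambda>x. f (x j)) \<longleftrightarrow> integrable M (\<lambda>\<omega>. f (Z j \<omega>))"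
    unfolding path_law_def by (subst integrable_distr_eq) measurable
  show "(\<integral>x. f (x j) \<partial>Q) = (\<integral>\<omega>. f (Z j \<omega>) \<partial>M)"
    unfolding path_law_def by (subst integral_distr) measurable
qed

end

section \<open>Linear bounds on past sums from ergodicity\<close>

locale ergodic_process = stationary_process +
  assumes ergodic: "ergodic_seq M Z"
begin

text \<open>The invariant event \<open>B\<close> has probability 0 or 1; the value 0 is excluded
  because almost surely unbounded sums force a nonnegative mean.\<close>

lemma AE_bdd_above_back_sum:
  fixes f :: "'b \<Rightarrow> real"
  assumes [measurable]: "f \<in> borel_measurable borel"
    and int: "integrable M (\<lambda>\<omega>. f (Z 0 \<omega>))" and neg: "(\<integral>\<omega>. f (Z 0 \<omega>) \<partial>M) < 0"
  shows "AE \<omega> in M. bdd_above (range (\<lambda>n. back_sum f n (\<lambda>j. Z j \<omega>)))"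
proof -
  interpret Q: prob_space Q by (rule prob_space_path_law)
  define B where "B = {x. bdd_above (range (\<lambda>n. back_sum f n x))}"
  have B [measurable]: "B \<in> sets Q"
  proof -
    have "{x \<in> space Q. bdd_above (range (\<lambda>n. back_sum f n x))} \<in> sets Q"
      by measurable
    then show ?thesis by (simp add: B_def)
  qed
  have "shift_seq -` B = B"
    by (auto simp: B_def bdd_above_back_sum_shift)
  then have "measure Q B \<in> {0, 1}"
    using ergodic B by (simp add: ergodic_seq_def)
  moreover have "measure Q B \<noteq> 0"
  proof
    assume "measure Q B = 0"
    then have "AE x in Q. x \<notin> B"
      by (subst (asm) Q.prob_eq_0) auto
    then have "0 \<le> (\<integral>x. f (x 0) \<partial>Q)"
      using int by (intro unbounded_back_sum_imp_integral_nonneg)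
        (auto simp: B_def integrable_coord_path_law)
    with neg show False
      by (simp add: integrable_coord_path_law)
  qed
  ultimately have "AE x in Q. x \<in> B"
    by (subst Q.prob_eq_1[symmetric]) auto
  then show ?thesis
    by (simp add: B_def AE_path_law)
qed

text \<open>Truncation at 1 provides an integrable function below \<open>g\<close> with positive
  mean \<open>m\<close>; comparing it with slope \<open>m / 2\<close> leaves the strictly negative
  drift \<open>- m / 2\<close>.\<close>

lemma AE_linear_lower_bound:
  fixes g :: "'b \<Rightarrow> real"
  assumes [measurable]: "g \<in> borel_measurable borel" and pos: "AE \<omega> in M. 0 < g (Z 0 \<omega>)"
  shows "\<exists>c>0. AE \<omega> in M. \<exists>K. \<forall>n. c * real n \<le> back_sum g n (\<lambda>j. Z j \<omega>) + K"
proof -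
  define m where "m = (\<integral>\<omega>. min 1 (g (Z 0 \<omega>)) \<partial>M)"
  have int: "integrable M (\<lambda>\<omega>. min 1 (g (Z 0 \<omega>)))"
    using pos by (intro integrable_const_bound[where B = 1]) auto
  have m: "0 < m"
    unfolding m_def using pos int by (intro expectation_greater) auto
  define f where "f = (\<lambda>y. m / 2 - min 1 (g y))"
  have "AE \<omega> in M. bdd_above (range (\<lambda>n. back_sum f n (\<lambda>j. Z j \<omega>)))"
    using int m by (intro AE_bdd_above_back_sum) (auto simp: f_def m_def[symmetric] prob_space)
  then have "AE \<omega> in M. \<exists>K. \<forall>n. m / 2 * real n \<le> back_sum g n (\<lambda>j. Z j \<omega>) + K"
  proof eventually_elim
    case (elim \<omega>)
    then obtain K where K: "\<And>n. back_sum f n (\<lambda>j. Z j \<omega>) \<le> K"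
      by (auto simp: bdd_above_def)
    have "m / 2 * real n - back_sum g n (\<lambda>j. Z j \<omega>) \<le> back_sum f n (\<lambda>j. Z j \<omega>)" for n
    proof -
      have "(\<Sum>k=1..n. min 1 (g (Z (- int k) \<omega>))) \<le> (\<Sum>k=1..n. g (Z (- int k) \<omega>))"
        by (intro sum_mono) auto
      then show ?thesis by (simp add: f_def back_sum_def sum_subtractf mult.commute)
    qed
    with K show ?case by (intro exI[of _ K]) (smt (verit))
  qed
  with m show ?thesis by (intro exI[of _ "m / 2"]) auto
qed

lemma AE_linear_upper_bound:
  fixes g :: "'b \<Rightarrow> real"
  assumes [measurable]: "g \<in> borel_measurable borel" and int: "integrable M (\<lambda>\<omega>. g (Z 0 \<omega>))"
  shows "\<exists>C>0. AE \<omega> in M. \<exists>K. \<forall>n. back_sum g n (\<lambda>j. Z j \<omega>) \<le> C * real n + K"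
proof -
  \<comment> \<open>The 1 makes the mean of \<open>f\<close> strictly negative; the absolute value
    keeps \<open>C\<close> positive.\<close>
  define C where "C = \<bar>\<integral>\<omega>. g (Z 0 \<omega>) \<partial>M\<bar> + 1"
  define f where "f = (\<lambda>y. g y - C)"
  have "AE \<omega> in M. bdd_above (range (\<lambda>n. back_sum f n (\<lambda>j. Z j \<omega>)))"
    using int by (intro AE_bdd_above_back_sum) (auto simp: f_def C_def prob_space)
  then have "AE \<omega> in M. \<exists>K. \<forall>n. back_sum g n (\<lambda>j. Z j \<omega>) \<le> C * real n + K"
  proof eventually_elim
    case (elim \<omega>)
    then obtain K where K: "\<And>n. back_sum f n (\<lambda>j. Z j \<omega>) \<le> K"
      by (auto simp: bdd_above_def)
    have "back_sum f n (\<lambda>j. Z j \<omega>) = back_sum g n (\<lambda>j. Z j \<omega>) - C * real n" for n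
      by (simp add: f_def back_sum_def sum_subtractf mult.commute)
    with K show ?case by (intro exI[of _ K]) (smt (verit))
  qed
  moreover have "C > 0" by (simp add: C_def)
  ultimately show ?thesis by blast
qed

end

subsection \<open>Tail sums and Borel--Cantelli arguments\<close>

lemma bdd_above_range_if_eventually_le:
  fixes X :: "nat \<Rightarrow> real"
  assumes "\<forall>\<^sub>F n in sequentially. X n \<le> K"
  shows "bdd_above (range X)"
proof -
  obtain N where N: "\<And>n. n \<ge> N \<Longrightarrow> X n \<le> K"
    using assms by (auto simp: eventually_sequentially)
  have "X n \<le> Max (insert K (X ` {..<N}))" for n
    using N[of n] by (cases "n < N") (auto simp: Max_ge_iff)
  then show ?thesis
    by (rule bdd_aboveI2)
qed

text \<open>Connects the extended-valued sum of the theorem with \<open>summable\<close>.\<close>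

lemma suminf_ennreal_finite_iff:
  assumes "\<And>n. 0 \<le> f n"
  shows "(\<Sum>n. ennreal (f n)) < \<infinity> \<longleftrightarrow> summable f"
proof
  assume "(\<Sum>n. ennreal (f n)) < \<infinity>"
  then show "summable f"
    using assms by (intro summable_suminf_not_top) auto
next
  assume "summable f"
  then show "(\<Sum>n. ennreal (f n)) < \<infinity>"
    by (metis assms ennreal_suminf_neq_top infinity_ennreal_def less_top)
qed

text \<open>The sum counts the \<open>k\<close> below \<open>(y - a) / c\<close>; \<open>nat\<close>
  returns the correct count 0 when \<open>y \<le> a\<close>.\<close>

lemma suminf_indicator_arith_progression:
  fixes a c y :: real
  assumes "c > 0"
  shows "(\<Sum>k. indicator {y. a + c * real k < y} y :: ennreal) = of_nat (nat \<lceil>(y - a) / c\<rceil>)"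
proof -
  define N where "N = nat \<lceil>(y - a) / c\<rceil>"
  have iff: "a + c * real k < y \<longleftrightarrow> k < N" for k
  proof -
    have "a + c * real k < y \<longleftrightarrow> real k < (y - a) / c"
      using assms by (simp add: field_simps)
    also have "\<dots> \<longleftrightarrow> k < N"
      unfolding N_def zless_nat_eq_int_zless less_ceiling_iff by simp
    finally show ?thesis .
  qed
  have "(\<Sum>k. indicator {y. a + c * real k < y} y :: ennreal)
      = (\<Sum>k\<in>{..<N}. indicator {y. a + c * real k < y} y)"
    by (rule suminf_finite) (auto simp: iff)
  also have "\<dots> = (\<Sum>k\<in>{..<N}. 1)"
    by (rule sum.cong) (auto simp: iff)
  finally show ?thesis by (simp add: N_def)
qed

section \<open>Tail probabilities and their sums\<close>

lemma tail_prob_nonneg: "0 \<le> tail_prob M Y x"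
  by (simp add: tail_prob_def)

lemma tail_prob_distr:
  assumes "Y \<in> borel_measurable M"
  shows "tail_prob M Y x = measure (distr M borel Y) {x<..}"
  using assms by (auto simp: tail_prob_def measure_distr intro!: arg_cong[where f = "measure M"])

context prob_space
begin

lemma antimono_tail_prob:
  assumes [measurable]: "Y \<in> borel_measurable M"
  shows "antimono (tail_prob M Y)"
proof (rule antimonoI)
  fix x y :: real
  assume "x \<le> y"
  then have "{\<omega> \<in> space M. Y \<omega> > y} \<subseteq> {\<omega> \<in> space M. Y \<omega> > x}"
    by auto
  then show "tail_prob M Y y \<le> tail_prob M Y x"
    unfolding tail_prob_def by (rule finite_measure_mono) measurable
qed

lemma measurable_tail_prob [measurable]:
  assumes "Y \<in> borel_measurable M"
  shows "tail_prob M Y \<in> borel_measurable borel"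
proof -
  have "mono (\<lambda>x. - tail_prob M Y x)"
    using antimono_tail_prob[OF assms] by (auto simp: mono_def antimono_def)
  then have "(\<lambda>x. - (- tail_prob M Y x)) \<in> borel_measurable borel"
    by (intro borel_measurable_uminus borel_measurable_mono)
  then show ?thesis by simp
qed

text \<open>By Tonelli the sum of the tails is the mean of the number \<open>N\<close> of
  progression points below \<open>Y\<close>. Finiteness passes between the means since
  \<open>Y \<le> \<bar>a\<bar> + c * N\<close> and
  \<open>N \<le> \<bar>a\<bar> / c + 1 + Y / c\<close>.\<close>

lemma summable_tail_prob_arith_progression_iff:
  fixes Y :: "'a \<Rightarrow> real"
  assumes Y [measurable]: "Y \<in> borel_measurable M"
    and nonneg: "\<And>\<omega>. \<omega> \<in> space M \<Longrightarrow> 0 \<le> Y \<omega>" and c: "c > 0"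
  shows "summable (\<lambda>k. tail_prob M Y (a + c * real k)) \<longleftrightarrow> (\<integral>\<^sup>+ \<omega>. ennreal (Y \<omega>) \<partial>M) < \<infinity>"
proof -
  define N where "N = (\<lambda>\<omega>. nat \<lceil>(Y \<omega> - a) / c\<rceil>)"
  have [measurable]: "N \<in> M \<rightarrow>\<^sub>M count_space UNIV"
    unfolding N_def by measurable
  have "ennreal (tail_prob M Y (a + c * real k))
      = (\<integral>\<^sup>+ \<omega>. indicator {y. a + c * real k < y} (Y \<omega>) \<partial>M)" for k
  proof -
    have "ennreal (tail_prob M Y (a + c * real k)) = emeasure M {\<omega> \<in> space M. a + c * real k < Y \<omega>}"
      by (simp add: tail_prob_def emeasure_eq_measure)
    also have "\<dots> = (\<integral>\<^sup>+ \<omega>. indicator {\<omega> \<in> space M. a + c * real k < Y \<omega>} \<omega> \<partial>M)"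
      by (rule nn_integral_indicator[symmetric]) measurable
    also have "\<dots> = (\<integral>\<^sup>+ \<omega>. indicator {y. a + c * real k < y} (Y \<omega>) \<partial>M)"
      by (rule nn_integral_cong) (auto simp: indicator_def)
    finally show ?thesis .
  qed
  then have "(\<Sum>k. ennreal (tail_prob M Y (a + c * real k)))
      = (\<integral>\<^sup>+ \<omega>. (\<Sum>k. indicator {y. a + c * real k < y} (Y \<omega>)) \<partial>M)"
    by (subst nn_integral_suminf) simp_all
  also have "\<dots> = (\<integral>\<^sup>+ \<omega>. ennreal (real (N \<omega>)) \<partial>M)"
    unfolding suminf_indicator_arith_progression[OF c] N_def by (simp add: ennreal_of_nat_eq_real_of_nat)
  finally have sum_eq: "(\<Sum>k. ennreal (tail_prob M Y (a + c * real k)))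
      = (\<integral>\<^sup>+ \<omega>. ennreal (real (N \<omega>)) \<partial>M)" .
  have "(\<integral>\<^sup>+ \<omega>. ennreal (real (N \<omega>)) \<partial>M) < \<infinity> \<longleftrightarrow> (\<integral>\<^sup>+ \<omega>. ennreal (Y \<omega>) \<partial>M) < \<infinity>"
  proof
    assume fin: "(\<integral>\<^sup>+ \<omega>. ennreal (real (N \<omega>)) \<partial>M) < \<infinity>"
    have "(\<integral>\<^sup>+ \<omega>. ennreal (Y \<omega>) \<partial>M) \<le> (\<integral>\<^sup>+ \<omega>. ennreal \<bar>a\<bar> + ennreal c * ennreal (real (N \<omega>)) \<partial>M)"
    proof (rule nn_integral_mono)
      fix \<omega>
      have "(Y \<omega> - a) / c \<le> real (N \<omega>)"
        unfolding N_def by linarith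
      then have "Y \<omega> \<le> \<bar>a\<bar> + c * real (N \<omega>)"
        using c by (simp add: field_simps)
      then show "ennreal (Y \<omega>) \<le> ennreal \<bar>a\<bar> + ennreal c * ennreal (real (N \<omega>))"
        using c by (simp flip: ennreal_mult ennreal_plus)
    qed
    also have "\<dots> = ennreal \<bar>a\<bar> + ennreal c * (\<integral>\<^sup>+ \<omega>. ennreal (real (N \<omega>)) \<partial>M)"
      by (simp add: nn_integral_add nn_integral_cmult emeasure_space_1)
    also have "\<dots> < \<infinity>"
      using fin by (simp add: ennreal_mult_less_top)
    finally show "(\<integral>\<^sup>+ \<omega>. ennreal (Y \<omega>) \<partial>M) < \<infinity>" .
  next
    assume fin: "(\<integral>\<^sup>+ \<omega>. ennreal (Y \<omega>) \<partial>M) < \<infinity>"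
    have "(\<integral>\<^sup>+ \<omega>. ennreal (real (N \<omega>)) \<partial>M)
        \<le> (\<integral>\<^sup>+ \<omega>. ennreal (\<bar>a\<bar> / c + 1) + ennreal (1 / c) * ennreal (Y \<omega>) \<partial>M)"
    proof (rule nn_integral_mono)
      fix \<omega> assume \<omega>: "\<omega> \<in> space M"
      have "real (N \<omega>) \<le> max 0 ((Y \<omega> - a) / c + 1)"
        unfolding N_def by linarith
      also have "\<dots> \<le> (\<bar>a\<bar> + Y \<omega>) / c + 1"
        using c nonneg[OF \<omega>] by (auto intro!: divide_right_mono add_nonneg_nonneg)
      also have "\<dots> = \<bar>a\<bar> / c + 1 + 1 / c * Y \<omega>"
        by (simp add: add_divide_distrib)
      finally show "ennreal (real (N \<omega>)) \<le> ennreal (\<bar>a\<bar> / c + 1) + ennreal (1 / c) * ennreal (Y \<omega>)"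
        using c nonneg[OF \<omega>] by (simp flip: ennreal_mult ennreal_plus)
    qed
    also have "\<dots> = ennreal (\<bar>a\<bar> / c + 1) + ennreal (1 / c) * (\<integral>\<^sup>+ \<omega>. ennreal (Y \<omega>) \<partial>M)"
      by (simp add: nn_integral_add nn_integral_cmult emeasure_space_1)
    also have "\<dots> < \<infinity>"
      using fin by (simp add: ennreal_mult_less_top)
    finally show "(\<integral>\<^sup>+ \<omega>. ennreal (real (N \<omega>)) \<partial>M) < \<infinity>" .
  qed
  then show ?thesis
    by (simp only: sum_eq[symmetric] suminf_ennreal_finite_iff tail_prob_nonneg)
qed

text \<open>First Borel--Cantelli lemma: almost surely \<open>Y n > a n\<close> only finitely often,
  and finitely many real values do not destroy boundedness.\<close>

lemma AE_bdd_above_if_summable_tail_prob: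
  fixes Y :: "nat \<Rightarrow> 'a \<Rightarrow> real"
  assumes [measurable]: "\<And>n. Y n \<in> borel_measurable M"
    and sum: "summable (\<lambda>n. tail_prob M (Y n) (a n))"
  shows "AE \<omega> in M. bdd_above (range (\<lambda>n. Y n \<omega> - a n))"
proof -
  have "AE \<omega> in M. \<forall>\<^sub>F n in sequentially. \<omega> \<in> space M - {\<omega> \<in> space M. Y n \<omega> > a n}"
    using sum by (intro borel_cantelli_AE1) (auto simp: tail_prob_def emeasure_eq_measure)
  then show ?thesis
  proof eventually_elim
    case (elim \<omega>)
    then have "\<forall>\<^sub>F n in sequentially. Y n \<omega> - a n \<le> 0"
      by eventually_elim auto
    then show ?case by (rule bdd_above_range_if_eventually_le)
  qed
qed

text \<open>For some \<open>K\<close> the event \<open>\<forall>n. Y\<^sub>n \<le> a\<^sub>n + K\<close> has probability \<open>\<delta> > 0\<close>, and by independence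
  \<open>\<delta> \<le> \<Prod>\<^bsub>n<N\<^esub> P (Y\<^sub>n \<le> a\<^sub>n + K) \<le> exp (- \<Sum>\<^bsub>n<N\<^esub> P (Y\<^sub>n > a\<^sub>n + K))\<close>.\<close>

lemma summable_tail_prob_if_AE_bdd_above:
  fixes Y :: "nat \<Rightarrow> 'a \<Rightarrow> real"
  assumes indep: "indep_vars (\<lambda>_. borel) Y UNIV"
    and bdd: "AE \<omega> in M. bdd_above (range (\<lambda>n. Y n \<omega> - a n))"
  shows "\<exists>K::nat. summable (\<lambda>n. tail_prob M (Y n) (a n + real K))"
proof -
  have [measurable]: "Y n \<in> borel_measurable M" for n
    using indep by (auto simp: indep_vars_def)
  define E where "E = (\<lambda>K::nat. {\<omega> \<in> space M. \<forall>n. Y n \<omega> \<le> a n + real K})"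
  have [measurable]: "E K \<in> events" for K
    unfolding E_def by measurable
  \<comment> \<open>The sets \<open>E K\<close> together cover almost every point by
    \<open>bdd\<close>, so they cannot all be null.\<close>
  have "\<exists>K. prob (E K) > 0"
  proof (rule ccontr)
    assume "\<not> ?thesis"
    then have "prob (E K) = 0" for K
      using measure_nonneg[of M "E K"] by (metis order_le_less)
    then have "AE \<omega> in M. \<forall>K. \<omega> \<notin> E K"
      by (auto simp: AE_all_countable prob_eq_0[symmetric])
    with bdd AE_space have "AE \<omega> in M. False"
    proof eventually_elim
      case (elim \<omega>)
      then obtain B where B: "\<And>n. Y n \<omega> - a n \<le> B"
        by (auto simp: bdd_above_def)
      obtain K where "B \<le> real K"
        using real_arch_simple by blast
      then have "Y n \<omega> \<le> a n + real K" for n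
        using B[of n] by simp
      with elim show False by (auto simp: E_def)
    qed
    then show False by simp
  qed
  then obtain K where K: "prob (E K) > 0" ..
  define p where "p = (\<lambda>n. tail_prob M (Y n) (a n + real K))"
  have "(\<Sum>n<N. p n) \<le> - ln (prob (E K))" for N
  \<comment> \<open>The product rule is applied to a nonempty index set; for \<open>N = 0\<close>
    the bound only says \<open>prob (E K) \<le> 1\<close>.\<close>
  proof (cases "N = 0")
    case False
    have "prob (E K) \<le> prob (\<Inter>n\<in>{..<N}. Y n -` {..a n + real K} \<inter> space M)"
      using False by (intro finite_measure_mono) (auto simp: E_def)
    also have "\<dots> = (\<Prod>n<N. prob (Y n -` {..a n + real K} \<inter> space M))"
      using False by (intro indep_varsD[OF indep]) auto
    also have "\<dots> = (\<Prod>n<N. 1 - p n)"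
    proof (rule prod.cong)
      fix n
      have "Y n -` {..a n + real K} \<inter> space M = space M - {\<omega> \<in> space M. Y n \<omega> > a n + real K}"
        by auto
      then show "prob (Y n -` {..a n + real K} \<inter> space M) = 1 - p n"
        by (simp add: prob_compl p_def tail_prob_def)
    qed simp
    also have "\<dots> \<le> (\<Prod>n<N. exp (- p n))"
      by (intro prod_mono) (auto simp: p_def tail_prob_def exp_minus_ge)
    also have "\<dots> = exp (- (\<Sum>n<N. p n))"
      by (simp add: exp_sum sum_negf[symmetric])
    finally have "ln (prob (E K)) \<le> ln (exp (- (\<Sum>n<N. p n)))"
      using K by (subst ln_le_cancel_iff) auto
    then show ?thesis by simp
  qed (use K in simp)
  then have "summable p"
    by (intro summableI_nonneg_bounded) (auto simp: p_def tail_prob_nonneg)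
  then show ?thesis by (auto simp: p_def)
qed

end

section \<open>Removing a random offset by stationarity\<close>

lemma (in finite_measure) measure_tendsto_0:
  assumes [measurable]: "\<And>n. A n \<in> sets M" and "AE x in M. \<forall>\<^sub>F n in sequentially. x \<notin> A n"
  shows "(\<lambda>n. measure M (A n)) \<longlonglongrightarrow> 0"
proof -
  have "(\<lambda>n. \<integral>x. indicator (A n) x \<partial>M) \<longlonglongrightarrow> (\<integral>x. (0::real) \<partial>M)"
  proof (rule integral_dominated_convergence[where w = "\<lambda>_. 1"])
    show "AE x in M. (\<lambda>n. indicator (A n) x) \<longlonglongrightarrow> (0::real)"
      using assms(2)
    proof eventually_elim
      case (elim x)
      then show ?case
        by (intro tendsto_eventually) (auto elim: eventually_mono)
    qed
  qed (auto simp: indicator_def)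
  moreover have "A n \<inter> space M = A n" for n
    using sets.sets_into_space[OF assms(1)[of n]] by blast
  ultimately show ?thesis by simp
qed

text \<open>After \<open>m\<close> shifts the past consists of \<open>m\<close> newer terms followed
  by the past of \<open>x\<close>.\<close>

lemma back_sum_funpow_shift:
  "back_sum f (n + m) ((shift_seq ^^ m) x) = back_sum f m ((shift_seq ^^ m) x) + back_sum f n x"
  by (induction m) (simp_all add: back_sum_shift)

lemma measurable_funpow_shift_seq [measurable]:
  "shift_seq ^^ m \<in> (\<Pi>\<^sub>M j\<in>UNIV. borel) \<rightarrow>\<^sub>M (\<Pi>\<^sub>M j\<in>UNIV. (borel :: 'b::topological_space measure))"
proof (induction m)
  case (Suc m)
  note [measurable] = Suc
  show ?case by simp
qed simp

context stationary_process
begin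

lemma measure_funpow_shift:
  assumes "Measurable.pred (\<Pi>\<^sub>M j\<in>UNIV. borel) P"
  shows "measure Q {x. P ((shift_seq ^^ m) x)} = measure Q {x. P x}"
proof (induction m)
  case (Suc m)
  note [measurable] = assms
  have "measure Q {x. P ((shift_seq ^^ m) (shift_seq x))} = measure Q {x. P ((shift_seq ^^ m) x)}"
    by (rule measure_shift) measurable
  with Suc show ?case by (simp add: funpow_swap1)
qed simp

text \<open>The constant \<open>K\<close> may depend on the path. For a path \<open>x\<close> with \<open>\<Sum>\<^sub>n F (S\<^sub>n x + K) < \<infinity>\<close>
  (where \<open>S\<^sub>n\<close> is \<open>back_sum g n\<close>), moving
  the origin \<open>m\<close> steps ahead gives a path \<open>y\<close> with \<open>S\<^bsub>n+m\<^esub> y = S\<^sub>m y + S\<^sub>n x\<close>, and \<open>S\<^sub>m y \<ge> K\<close>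
  with probability close to 1. By stationarity \<open>y\<close> has the same law as \<open>x\<close>.\<close>

lemma AE_summable_antimono_back_sum:
  fixes g :: "'b \<Rightarrow> real" and F :: "real \<Rightarrow> real"
  assumes [measurable]: "g \<in> borel_measurable borel" "F \<in> borel_measurable borel"
    and anti: "antimono F" and F_nonneg: "\<And>x. 0 \<le> F x"
    and lim: "AE \<omega> in M. filterlim (\<lambda>n. back_sum g n (\<lambda>j. Z j \<omega>)) at_top sequentially"
    and sum: "AE \<omega> in M. \<exists>K::nat. summable (\<lambda>n. F (back_sum g n (\<lambda>j. Z j \<omega>) + real K))"
  shows "AE \<omega> in M. summable (\<lambda>n. F (back_sum g n (\<lambda>j. Z j \<omega>)))"
proof -
  interpret Q: prob_space Q by (rule prob_space_path_law)
  define G where "G = (\<lambda>K x. summable (\<lambda>n. F (back_sum g n x + K)))"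
  have pred_G [measurable]: "Measurable.pred (\<Pi>\<^sub>M j\<in>UNIV. borel) (G K)" for K
    \<comment> \<open>Summability becomes measurable as finiteness of an \<open>ennreal\<close>
      sum.\<close>
    unfolding G_def suminf_ennreal_finite_iff[OF F_nonneg, symmetric] by measurable
  \<comment> \<open>Two failures are separated: the offset \<open>K\<close> does not give
    summability, or \<open>m\<close> terms do not reach \<open>K\<close>. Sending first
    \<open>m\<close> and then \<open>K\<close> to infinity makes both vanish.\<close>
  have le: "measure Q {x. \<not> G 0 x}
      \<le> measure Q {x. \<not> G (real K) x} + measure Q {x. back_sum g m x < real K}" for K m :: nat
  proof -
    have "G 0 ((shift_seq ^^ m) x)"
      if x: "G (real K) x" and y: "real K \<le> back_sum g m ((shift_seq ^^ m) x)" for x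
    proof -
      have "summable (\<lambda>n. F (back_sum g (n + m) ((shift_seq ^^ m) x)))"
        using x[unfolded G_def]
      proof (rule summable_comparison_test_ev[rotated], intro always_eventually allI)
        fix n
        have "F (back_sum g (n + m) ((shift_seq ^^ m) x)) \<le> F (back_sum g n x + real K)"
          using y by (intro antimonoD[OF anti]) (simp add: back_sum_funpow_shift)
        then show "norm (F (back_sum g (n + m) ((shift_seq ^^ m) x))) \<le> F (back_sum g n x + real K)"
          using F_nonneg by simp
      qed
      \<comment> \<open>The first \<open>m\<close> terms do not affect summability.\<close>
      then show ?thesis
        using summable_iff_shift[of "\<lambda>n. F (back_sum g n ((shift_seq ^^ m) x))" m] by (simp add: G_def)
    qed
    then have "{x. \<not> G 0 ((shift_seq ^^ m) x)}
        \<subseteq> {x. \<not> G (real K) x} \<union> {x. back_sum g m ((shift_seq ^^ m) x) < real K}"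
      by force
    then have "measure Q {x. \<not> G 0 ((shift_seq ^^ m) x)}
        \<le> measure Q ({x. \<not> G (real K) x} \<union> {x. back_sum g m ((shift_seq ^^ m) x) < real K})"
      by (intro Q.finite_measure_mono sets.Un pred_setsD) measurable
    also have "\<dots> \<le> measure Q {x. \<not> G (real K) x}
        + measure Q {x. back_sum g m ((shift_seq ^^ m) x) < real K}"
      by (intro measure_Un_le pred_setsD) measurable
    finally show ?thesis
      using measure_funpow_shift[of "\<lambda>x. \<not> G 0 x" m]
        measure_funpow_shift[of "\<lambda>x. back_sum g m x < real K" m] by simp
  qed
  \<comment> \<open>For fixed \<open>K\<close>, divergence of the past sums makes the second term
    vanish as \<open>m\<close> grows.\<close>
  have "(\<lambda>m. measure Q {x. back_sum g m x < real K}) \<longlonglongrightarrow> 0" for K :: nat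
  proof (rule Q.measure_tendsto_0)
    have "AE \<omega> in M. \<forall>\<^sub>F m in sequentially. \<not> back_sum g m (\<lambda>j. Z j \<omega>) < real K"
      using lim by eventually_elim (simp add: filterlim_at_top not_less)
    then show "AE x in Q. \<forall>\<^sub>F m in sequentially. x \<notin> {x. back_sum g m x < real K}"
      unfolding eventually_sequentially by (subst AE_path_law) auto
  qed (intro pred_setsD, measurable)
  then have lim_le: "(\<lambda>m. measure Q {x. \<not> G (real K) x} + measure Q {x. back_sum g m x < real K})
      \<longlonglongrightarrow> measure Q {x. \<not> G (real K) x} + 0" for K :: nat
    by (intro tendsto_add tendsto_const)
  have le': "measure Q {x. \<not> G 0 x} \<le> measure Q {x. \<not> G (real K) x}" for K :: nat
    using LIMSEQ_le_const[OF lim_le[of K], of "measure Q {x. \<not> G 0 x}"] le[of K] by simp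
  \<comment> \<open>Since \<open>F\<close> is antitone, summability for one offset persists for all
    larger ones, so almost every path eventually leaves the failure sets.\<close>
  have "(\<lambda>K::nat. measure Q {x. \<not> G (real K) x}) \<longlonglongrightarrow> 0"
  proof (rule Q.measure_tendsto_0)
    have "AE \<omega> in M. \<forall>\<^sub>F K::nat in sequentially. G (real K) (\<lambda>j. Z j \<omega>)"
      using sum
    proof eventually_elim
      case (elim \<omega>)
      then obtain K0 :: nat where K0: "G (real K0) (\<lambda>j. Z j \<omega>)"
        unfolding G_def by blast
      have "G (real K) (\<lambda>j. Z j \<omega>)" if "K \<ge> K0" for K
        using K0 unfolding G_def
      proof (rule summable_comparison_test_ev[rotated], intro always_eventually allI)
        fix n
        have "F (back_sum g n (\<lambda>j. Z j \<omega>) + real K) \<le> F (back_sum g n (\<lambda>j. Z j \<omega>) + real K0)"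
          using that by (intro antimonoD[OF anti]) simp
        then show "norm (F (back_sum g n (\<lambda>j. Z j \<omega>) + real K)) \<le> F (back_sum g n (\<lambda>j. Z j \<omega>) + real K0)"
          using F_nonneg by simp
      qed
      then show ?case by (rule eventually_sequentiallyI)
    qed
    then show "AE x in Q. \<forall>\<^sub>F K::nat in sequentially. x \<notin> {x. \<not> G (real K) x}"
      unfolding eventually_sequentially by (subst AE_path_law) auto
  qed (intro pred_setsD, measurable)
  then have "measure Q {x. \<not> G 0 x} \<le> 0"
    using le' by (intro LIMSEQ_le_const) auto
  then have "AE x in Q. x \<notin> {x. \<not> G 0 x}"
    by (subst Q.prob_eq_0[symmetric]) (auto intro!: pred_setsD antisym)
  then show ?thesis
    using AE_path_law[OF pred_G[of 0]] by (simp add: G_def)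
qed

end

subsection \<open>The stationary queue\<close>

text \<open>Two readings: the process \<open>t\<close> alone serves (A2), the pair process serves
  (A1).\<close>

lemma T_tilde_eq_back_sum:
  "T_tilde t n \<omega> = back_sum (\<lambda>u. u) n (\<lambda>j. t j \<omega>)"
  "T_tilde t n \<omega> = back_sum snd n (\<lambda>j. (s j \<omega>, t j \<omega>))"
  by (simp_all add: T_tilde_def back_sum_def)

text \<open>Reindexing by \<open>j = Suc n\<close> pairs each service time with
  \<open>T_tilde t n\<close>; for real terms, finiteness of the supremum amounts to a real upper
  bound.\<close>

lemma X_tilde_inf_finite_iff:
  "X_tilde_inf s t \<omega> < \<infinity> \<longleftrightarrow>
     bdd_above (range (\<lambda>n. s (- int (Suc n)) \<omega> - T_tilde t n \<omega>))"
proof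
  assume fin: "X_tilde_inf s t \<omega> < \<infinity>"
  have le: "ereal (s (- int (Suc n)) \<omega> - T_tilde t n \<omega>) \<le> X_tilde_inf s t \<omega>" for n
  proof -
    have "ereal (s (- int (Suc n)) \<omega> - T_tilde t (Suc n - 1) \<omega>)
        \<le> (SUP j\<in>{1::nat..}. ereal (s (- int j) \<omega> - T_tilde t (j - 1) \<omega>))"
      by (rule SUP_upper) simp
    then show ?thesis
      unfolding X_tilde_inf_def by (simp add: le_max_iff_disj)
  qed
  \<comment> \<open>Nonnegativity rules out -\<infinity>, so a value below \<infinity> is
    real.\<close>
  have "0 \<le> X_tilde_inf s t \<omega>"
    by (simp add: X_tilde_inf_def)
  with fin obtain r where "X_tilde_inf s t \<omega> = ereal r"
    by (cases "X_tilde_inf s t \<omega>") auto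
  with le show "bdd_above (range (\<lambda>n. s (- int (Suc n)) \<omega> - T_tilde t n \<omega>))"
    by (intro bdd_aboveI2[where M = r]) (metis ereal_less_eq(3))
next
  assume "bdd_above (range (\<lambda>n. s (- int (Suc n)) \<omega> - T_tilde t n \<omega>))"
  then obtain K where K: "\<And>n. s (- int (Suc n)) \<omega> - T_tilde t n \<omega> \<le> K"
    by (auto simp: bdd_above_def)
  have "(SUP j\<in>{1::nat..}. ereal (s (- int j) \<omega> - T_tilde t (j - 1) \<omega>)) \<le> ereal K"
  proof (rule SUP_least)
    fix j :: nat
    assume "j \<in> {1..}"
    then show "ereal (s (- int j) \<omega> - T_tilde t (j - 1) \<omega>) \<le> ereal K"
      using K[of "j - 1"] by simp
  qed
  then have "X_tilde_inf s t \<omega> \<le> max 0 (ereal K)"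
    unfolding X_tilde_inf_def by (rule max.mono[OF order_refl])
  also have "\<dots> < \<infinity>"
    by (simp add: max_def)
  finally show "X_tilde_inf s t \<omega> < \<infinity>" .
qed

section \<open>Equal laws, sections of events, reindexed independence\<close>

lemma nn_integral_eq_if_distr_eq:
  assumes "X \<in> borel_measurable M" "Y \<in> borel_measurable M" "f \<in> borel_measurable borel"
    and "distr M borel X = distr M borel Y"
  shows "(\<integral>\<^sup>+ \<omega>. f (X \<omega>) \<partial>M) = (\<integral>\<^sup>+ \<omega>. f (Y \<omega>) \<partial>M)"
  using arg_cong[OF assms(4), of "\<lambda>D. \<integral>\<^sup>+ x. f x \<partial>D"] assms(1-3) by (simp add: nn_integral_distr)

text \<open>The inner statement says that a section of the exceptional set is null, and section
  measures depend measurably on the parameter. This serves the freezing of the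
  \<open>t\<close>-path.\<close>

lemma (in sigma_finite_measure) pred_AE:
  assumes P: "Measurable.pred (N \<Otimes>\<^sub>M M) (\<lambda>z. P (fst z) (snd z))"
  shows "Measurable.pred N (\<lambda>x. AE y in M. P x y)"
proof -
  have "(AE y in M. P x y) \<longleftrightarrow> emeasure M {y \<in> space M. \<not> P x y} = 0" if "x \<in> space N" for x
  proof (rule AE_iff_measurable)
    have "Measurable.pred M (\<lambda>y. P x y)"
      using measurable_compose[OF measurable_Pair1'[OF that] P] by simp
    then show "{y \<in> space M. \<not> P x y} \<in> sets M"
      by measurable
  qed simp
  moreover have "(\<lambda>x. emeasure M {y \<in> space M. \<not> P x y}) \<in> borel_measurable N"
  proof (rule measurable_emeasure)
    have "{z \<in> space (N \<Otimes>\<^sub>M M). \<not> P (fst z) (snd z)} \<in> sets (N \<Otimes>\<^sub>M M)"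
      using P by measurable
    also have "{z \<in> space (N \<Otimes>\<^sub>M M). \<not> P (fst z) (snd z)}
        = {z \<in> space (N \<Otimes>\<^sub>M M). snd z \<in> {y \<in> space M. \<not> P (fst z) y}}"
      by (auto simp: space_pair_measure)
    finally show "{z \<in> space (N \<Otimes>\<^sub>M M). snd z \<in> {y \<in> space M. \<not> P (fst z) y}} \<in> sets (N \<Otimes>\<^sub>M M)" .
  qed auto
  then have "Measurable.pred N (\<lambda>x. emeasure M {y \<in> space M. \<not> P x y} = 0)"
    by measurable
  ultimately show ?thesis
    by (simp cong: measurable_cong)
qed

text \<open>Used to list the past service times by natural numbers. Injectivity identifies a product
  over \<open>J\<close> with one over its image.\<close>

lemma (in prob_space) indep_vars_reindex_inj:
  assumes indep: "indep_vars (\<lambda>_. N) X UNIV" and r: "inj r"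
  shows "indep_vars (\<lambda>_. N) (\<lambda>i. X (r i)) UNIV"
  unfolding indep_vars_def2
proof (intro conjI ballI indep_setsI)
  show "random_variable N (X (r i))" for i
    using indep by (auto simp: indep_vars_def2)
  then show "{X (r i) -` A \<inter> space M |A. A \<in> sets N} \<subseteq> events" for i
    by (auto intro: measurable_sets)
next
  fix A J
  assume J: "J \<noteq> {}" "finite J" and A: "\<forall>j\<in>J. A j \<in> {X (r j) -` A \<inter> space M |A. A \<in> sets N}"
  have "indep_sets (\<lambda>i. {X i -` A \<inter> space M |A. A \<in> sets N}) UNIV"
    using indep by (simp add: indep_vars_def2)
  then have "prob (\<Inter>j\<in>r ` J. A (inv r j)) = (\<Prod>j\<in>r ` J. prob (A (inv r j)))"
    using J A r by (intro indep_setsD) auto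
  then show "prob (\<Inter>j\<in>J. A j) = (\<Prod>j\<in>J. prob (A j))"
    using r by (simp add: prod.reindex inj_on_subset[OF r])
qed

text \<open>Up to a random constant, \<open>T_tilde t n\<close> is at least
  \<open>c * real n\<close>; a finite mean makes the tails of \<open>s 1\<close> at
  \<open>c * real n\<close> summable, so the past service times exceed this line by a bounded amount
  only.\<close>

lemma (in prob_space) AE_X_tilde_inf_finite_if_A1:
  fixes s t :: "int \<Rightarrow> 'a \<Rightarrow> real"
  assumes s [measurable]: "\<And>j. s j \<in> borel_measurable M"
    and s_pos: "\<And>j \<omega>. \<omega> \<in> space M \<Longrightarrow> 0 < s j \<omega>"
    and t_pos: "\<And>j \<omega>. \<omega> \<in> space M \<Longrightarrow> 0 < t j \<omega>"
    and A1: "assumption_A1 M s t" and fin: "(\<integral>\<^sup>+ \<omega>. ennreal (s 1 \<omega>) \<partial>M) < \<infinity>"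
  shows "AE \<omega> in M. X_tilde_inf s t \<omega> < \<infinity>"
proof -
  interpret Z: ergodic_process M "\<lambda>j \<omega>. (s j \<omega>, t j \<omega>)"
    using A1 by unfold_locales (auto simp: assumption_A1_def)
  have [measurable]: "fst \<in> borel_measurable (borel :: (real \<times> real) measure)"
    "snd \<in> borel_measurable (borel :: (real \<times> real) measure)"
    by (auto intro!: borel_measurable_continuous_onI continuous_intros)
  \<comment> \<open>Stationarity is available for the pair process; the law of \<open>s j\<close> is
    its first marginal.\<close>
  have s_tail: "tail_prob M (s j) x = tail_prob M (s 1) x" for j x
  proof -
    have "tail_prob M (s j) x = measure (distr M borel (\<lambda>\<omega>. (s j \<omega>, t j \<omega>))) {p. fst p > x}" for j
    proof -
      have "{p :: real \<times> real. fst p > x} = {p \<in> space borel. fst p > x}" by simp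
      also have "\<dots> \<in> sets borel" by measurable
      finally show ?thesis
        using Z.measurable_coord[of j]
        by (auto simp: tail_prob_def measure_distr intro!: arg_cong[where f = "measure M"])
    qed
    then show ?thesis using Z.distr_coord[of j] Z.distr_coord[of 1] by simp
  qed
  obtain c where c: "c > 0"
    and lower: "AE \<omega> in M. \<exists>K. \<forall>n. c * real n \<le> back_sum snd n (\<lambda>j. (s j \<omega>, t j \<omega>)) + K"
    using Z.AE_linear_lower_bound[of snd] t_pos by (auto intro: AE_I2)
  have "summable (\<lambda>n. tail_prob M (s 1) (0 + c * real n))"
    using fin c s_pos by (subst summable_tail_prob_arith_progression_iff) (auto intro: less_imp_le)
  then have "summable (\<lambda>n. tail_prob M (s (- int (Suc n))) (c * real n))"
    by (subst s_tail) simp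
  then have "AE \<omega> in M. bdd_above (range (\<lambda>n. s (- int (Suc n)) \<omega> - c * real n))"
    by (intro AE_bdd_above_if_summable_tail_prob) auto
  with lower show ?thesis
  proof eventually_elim
    case (elim \<omega>)
    then obtain K B where K: "\<And>n. c * real n \<le> T_tilde t n \<omega> + K"
      and B: "\<And>n. s (- int (Suc n)) \<omega> - c * real n \<le> B"
      by (auto simp: bdd_above_def T_tilde_eq_back_sum(2)[of t _ \<omega> s])
    show ?case
      unfolding X_tilde_inf_finite_iff
    proof (rule bdd_aboveI2)
      show "s (- int (Suc n)) \<omega> - T_tilde t n \<omega> \<le> B + K" for n
        using K[of n] B[of n] by linarith
    qed
  qed
qed

section \<open>The queue under (A2)\<close>

locale queue_A2 = prob_space M
  for M :: "'a measure" +
  fixes s t :: "int \<Rightarrow> 'a \<Rightarrow> real"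
  assumes s_measurable [measurable]: "\<And>j. s j \<in> borel_measurable M"
    and t_measurable [measurable]: "\<And>j. t j \<in> borel_measurable M"
    and s_pos: "\<And>j \<omega>. \<omega> \<in> space M \<Longrightarrow> 0 < s j \<omega>"
    and t_pos: "\<And>j \<omega>. \<omega> \<in> space M \<Longrightarrow> 0 < t j \<omega>"
    and A2: "assumption_A2 M s t"

sublocale queue_A2 \<subseteq> t: ergodic_process M t
  using A2 by unfold_locales (auto simp: assumption_A2_def)

context queue_A2
begin

lemma T_tilde_measurable [measurable]: "T_tilde t n \<in> borel_measurable M"
  unfolding T_tilde_def by measurable

lemma s_distr: "distr M borel (s i) = distr M borel (s j)"
  using A2 unfolding assumption_A2_def iid_seq_def by blast

lemma s_tail_prob: "tail_prob M (s j) = tail_prob M (s 1)"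
  using s_distr[of j 1] by (auto simp: tail_prob_distr fun_eq_iff)

lemma s_indep: "indep_vars (\<lambda>_. borel) (\<lambda>n. s (- int (Suc n))) (UNIV :: nat set)"
proof (rule indep_vars_reindex_inj)
  show "indep_vars (\<lambda>_. borel) s UNIV"
    using A2 unfolding assumption_A2_def iid_seq_def by blast
qed (simp add: inj_on_def)

text \<open>Independence makes the joint path law a product, so by Fubini the \<open>t\<close>-path
  can be frozen at \<open>\<omega>\<close> while a separate \<open>\<omega>'\<close> drives the
  \<open>s\<close>-path.\<close>

lemma AE_X_tilde_inf_finite_iff_AE_AE:
  "(AE \<omega> in M. X_tilde_inf s t \<omega> < \<infinity>) \<longleftrightarrow>
     (AE \<omega> in M. AE \<omega>' in M. bdd_above (range (\<lambda>n. s (- int (Suc n)) \<omega>' - T_tilde t n \<omega>)))"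
proof -
  let ?P = "\<Pi>\<^sub>M j\<in>(UNIV :: int set). (borel :: real measure)"
  let ?s = "\<lambda>\<omega> j. s j \<omega>" and ?t = "\<lambda>\<omega> j. t j \<omega>"
  \<comment> \<open>The event is expressed on pairs of paths, where the product law lives.\<close>
  define \<Phi> where "\<Phi> = (\<lambda>(x :: int \<Rightarrow> real) (y :: int \<Rightarrow> real).
    bdd_above (range (\<lambda>n. x (- int (Suc n)) - back_sum (\<lambda>u. u) n y)))"
  have \<Phi>: "\<Phi> (?s \<omega>') (?t \<omega>)
      \<longleftrightarrow> bdd_above (range (\<lambda>n. s (- int (Suc n)) \<omega>' - T_tilde t n \<omega>))" for \<omega>' \<omega>
    by (simp add: \<Phi>_def T_tilde_eq_back_sum(1))
  have [measurable]: "?s \<in> M \<rightarrow>\<^sub>M ?P" "?t \<in> M \<rightarrow>\<^sub>M ?P"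
    by (auto intro!: measurable_PiM_single')
  have pred_\<Phi> [measurable]: "Measurable.pred (?P \<Otimes>\<^sub>M ?P) (\<lambda>z. \<Phi> (fst z) (snd z))"
    unfolding \<Phi>_def by measurable
  interpret S: prob_space "distr M ?P ?s" by (rule prob_space_distr) measurable
  interpret T: prob_space "distr M ?P ?t" by (rule prob_space_distr) measurable
  interpret ST: pair_prob_space "distr M ?P ?s" "distr M ?P ?t" ..
  have sets: "{z \<in> space (distr M ?P ?s \<Otimes>\<^sub>M distr M ?P ?t). \<Phi> (fst z) (snd z)}
      \<in> sets (distr M ?P ?s \<Otimes>\<^sub>M distr M ?P ?t)"
    using pred_\<Phi> by (simp add: pred_def space_pair_measure cong: sets_pair_measure_cong)
  have "indep_var ?P ?s ?P ?t"
    using A2 by (simp add: assumption_A2_def)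
  then have joint: "distr M ?P ?s \<Otimes>\<^sub>M distr M ?P ?t = distr M (?P \<Otimes>\<^sub>M ?P) (\<lambda>\<omega>. (?s \<omega>, ?t \<omega>))"
    by (simp add: indep_var_distribution_eq)
  have "(AE \<omega> in M. X_tilde_inf s t \<omega> < \<infinity>) \<longleftrightarrow> (AE \<omega> in M. \<Phi> (?s \<omega>) (?t \<omega>))"
    by (simp only: X_tilde_inf_finite_iff \<Phi>)
  also have "\<dots> \<longleftrightarrow> (AE z in distr M (?P \<Otimes>\<^sub>M ?P) (\<lambda>\<omega>. (?s \<omega>, ?t \<omega>)). \<Phi> (fst z) (snd z))"
    using pred_\<Phi> by (subst AE_distr_iff) (auto simp: pred_def)
  also have "\<dots> \<longleftrightarrow> (AE x in distr M ?P ?s. AE y in distr M ?P ?t. \<Phi> x y)"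
    unfolding joint[symmetric] by (rule ST.AE_pair_iff[OF sets, symmetric])
  \<comment> \<open>The \<open>t\<close>-path moves to the outer position, since it is the one to be
    frozen.\<close>
  also have "\<dots> \<longleftrightarrow> (AE y in distr M ?P ?t. AE x in distr M ?P ?s. \<Phi> x y)"
    by (rule ST.AE_commute[OF sets])
  also have "\<dots> \<longleftrightarrow> (AE y in distr M ?P ?t. AE \<omega>' in M. \<Phi> (?s \<omega>') y)"
  proof (rule AE_cong)
    fix y
    have "{x \<in> space ?P. \<Phi> x y} \<in> sets ?P"
      unfolding \<Phi>_def by measurable
    then show "(AE x in distr M ?P ?s. \<Phi> x y) \<longleftrightarrow> (AE \<omega>' in M. \<Phi> (?s \<omega>') y)"
      by (subst AE_distr_iff) auto
  qed
  also have "\<dots> \<longleftrightarrow> (AE \<omega> in M. AE \<omega>' in M. \<Phi> (?s \<omega>') (?t \<omega>))"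
  proof (rule AE_distr_iff)
    have "Measurable.pred (?P \<Otimes>\<^sub>M M) (\<lambda>z. \<Phi> (?s (snd z)) (fst z))"
      unfolding \<Phi>_def by measurable
    then have "Measurable.pred ?P (\<lambda>y. AE \<omega>' in M. \<Phi> (?s \<omega>') y)"
      by (rule pred_AE)
    then show "{y \<in> space ?P. AE \<omega>' in M. \<Phi> (?s \<omega>') y} \<in> sets ?P"
      by (simp add: pred_def)
  qed measurable
  finally show ?thesis by (simp only: \<Phi>)
qed

lemma AE_X_tilde_inf_finite_iff_AE_summable:
  "(AE \<omega> in M. X_tilde_inf s t \<omega> < \<infinity>) \<longleftrightarrow>
     (AE \<omega> in M. summable (\<lambda>n. tail_prob M (s 1) (T_tilde t n \<omega>)))"
proof
  assume "AE \<omega> in M. X_tilde_inf s t \<omega> < \<infinity>"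
  \<comment> \<open>The independence argument is run for each frozen \<open>\<omega>\<close>, so
    \<open>K\<close> depends on \<open>\<omega>\<close>;
    \<open>AE_summable_antimono_back_sum\<close> removes it at the end.\<close>
  then have "AE \<omega> in M. \<exists>K::nat. summable (\<lambda>n. tail_prob M (s 1) (T_tilde t n \<omega> + real K))"
    unfolding AE_X_tilde_inf_finite_iff_AE_AE
  proof eventually_elim
    case (elim \<omega>)
    from summable_tail_prob_if_AE_bdd_above[OF s_indep elim] show ?case
      by (simp only: s_tail_prob[of "- int (Suc n)" for n])
  qed
  moreover have "AE \<omega> in M. filterlim (\<lambda>n. T_tilde t n \<omega>) at_top sequentially"
  proof -
    obtain c where c: "c > 0"
      and lower: "AE \<omega> in M. \<exists>K. \<forall>n. c * real n \<le> back_sum (\<lambda>u. u) n (\<lambda>j. t j \<omega>) + K"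
      using t.AE_linear_lower_bound[of "\<lambda>u. u"] t_pos by (auto intro: AE_I2)
    from lower show ?thesis
    proof eventually_elim
      case (elim \<omega>)
      then obtain K where K: "\<And>n. c * real n \<le> T_tilde t n \<omega> + K"
        by (auto simp: T_tilde_eq_back_sum(1))
      have "filterlim (\<lambda>n. - K + c * real n) at_top sequentially"
        using c by (intro filterlim_tendsto_add_at_top[OF tendsto_const]
            filterlim_tendsto_pos_mult_at_top[OF tendsto_const] filterlim_real_sequentially)
      then show ?case
        by (rule filterlim_at_top_mono) (use K in \<open>auto simp: algebra_simps\<close>)
    qed
  qed
  ultimately show "AE \<omega> in M. summable (\<lambda>n. tail_prob M (s 1) (T_tilde t n \<omega>))"
    unfolding T_tilde_eq_back_sum(1)
    by (intro t.AE_summable_antimono_back_sum) (auto intro: antimono_tail_prob tail_prob_nonneg)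
next
  assume "AE \<omega> in M. summable (\<lambda>n. tail_prob M (s 1) (T_tilde t n \<omega>))"
  then show "AE \<omega> in M. X_tilde_inf s t \<omega> < \<infinity>"
    unfolding AE_X_tilde_inf_finite_iff_AE_AE
  proof eventually_elim
    case (elim \<omega>)
    then show ?case
      by (intro AE_bdd_above_if_summable_tail_prob) (simp_all only: s_tail_prob[of "- int (Suc n)" for n] s_measurable)
  qed
qed

text \<open>Since tails decrease, the bound \<open>C * real n + K\<close> on
  \<open>T_tilde t n\<close> carries summability over to an arithmetic progression, where it means a
  finite mean.\<close>

lemma nn_integral_s_finite:
  assumes t_fin: "(\<integral>\<^sup>+ \<omega>. ennreal (t 1 \<omega>) \<partial>M) < \<infinity>"
    and X_fin: "AE \<omega> in M. X_tilde_inf s t \<omega> < \<infinity>"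
  shows "(\<integral>\<^sup>+ \<omega>. ennreal (s 1 \<omega>) \<partial>M) < \<infinity>"
proof -
  \<comment> \<open>The linear bound asks for integrability at coordinate 0, the hypothesis speaks
    of coordinate 1.\<close>
  have "(\<integral>\<^sup>+ \<omega>. ennreal (t 0 \<omega>) \<partial>M) = (\<integral>\<^sup>+ \<omega>. ennreal (t 1 \<omega>) \<partial>M)"
    using t.distr_coord[of 1] by (intro nn_integral_eq_if_distr_eq) auto
  with t_fin have "integrable M (t 0)"
    using t_pos by (intro integrableI_nonneg) (auto intro: less_imp_le)
  then obtain C where C: "C > 0"
    and upper: "AE \<omega> in M. \<exists>K. \<forall>n. back_sum (\<lambda>u. u) n (\<lambda>j. t j \<omega>) \<le> C * real n + K"
    using t.AE_linear_upper_bound[of "\<lambda>u. u"] by auto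
  have "AE \<omega> in M. summable (\<lambda>n. tail_prob M (s 1) (T_tilde t n \<omega>))"
    using X_fin by (simp only: AE_X_tilde_inf_finite_iff_AE_summable)
  with upper have "AE \<omega> in M. \<exists>K. summable (\<lambda>n. tail_prob M (s 1) (K + C * real n))"
  proof eventually_elim
    case (elim \<omega>)
    then obtain K where K: "\<And>n. T_tilde t n \<omega> \<le> C * real n + K"
      by (auto simp: T_tilde_eq_back_sum(1))
    have "summable (\<lambda>n. tail_prob M (s 1) (K + C * real n))"
      using elim(2)
    proof (rule summable_comparison_test_ev[rotated], intro always_eventually allI)
      fix n
      have "tail_prob M (s 1) (K + C * real n) \<le> tail_prob M (s 1) (T_tilde t n \<omega>)"
        using K[of n] by (intro antimonoD[OF antimono_tail_prob]) auto
      then show "norm (tail_prob M (s 1) (K + C * real n)) \<le> tail_prob M (s 1) (T_tilde t n \<omega>)"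
        by (simp add: tail_prob_nonneg)
    qed
    then show ?case ..
  qed
  \<comment> \<open>For every \<open>K\<close> summability is equivalent to the finite mean, a
    statement that no longer depends on the sample point.\<close>
  then have "AE \<omega> in M. (\<integral>\<^sup>+ \<omega>. ennreal (s 1 \<omega>) \<partial>M) < \<infinity>"
    using C s_pos by (subst (asm) summable_tail_prob_arith_progression_iff) (auto intro: less_imp_le)
  then show ?thesis
    by (simp only: AE_const)
qed

text \<open>The series of the theorem starts at \<open>T_tilde t 1 \<omega>\<close>, the previous
  criterion at \<open>T_tilde t 0 \<omega>\<close>; one term does not affect convergence.\<close>

lemma AE_X_tilde_inf_finite_iff_prob:
  "(AE \<omega> in M. X_tilde_inf s t \<omega> < \<infinity>) \<longleftrightarrow>
     \<P>(\<omega> in M. (\<Sum>k. ennreal (tail_prob M (s 1) (T_tilde t (Suc k) \<omega>))) < \<infinity>) = 1"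
proof -
  have "summable (\<lambda>n. tail_prob M (s 1) (T_tilde t n \<omega>)) \<longleftrightarrow>
      (\<Sum>k. ennreal (tail_prob M (s 1) (T_tilde t (Suc k) \<omega>))) < \<infinity>" for \<omega>
    using summable_Suc_iff[of "\<lambda>n. tail_prob M (s 1) (T_tilde t n \<omega>)"]
    by (simp only: suminf_ennreal_finite_iff tail_prob_nonneg)
  then have "(AE \<omega> in M. X_tilde_inf s t \<omega> < \<infinity>) \<longleftrightarrow>
      (AE \<omega> in M. (\<Sum>k. ennreal (tail_prob M (s 1) (T_tilde t (Suc k) \<omega>))) < \<infinity>)"
    by (simp only: AE_X_tilde_inf_finite_iff_AE_summable)
  also have "\<dots> \<longleftrightarrow>
      \<P>(\<omega> in M. (\<Sum>k. ennreal (tail_prob M (s 1) (T_tilde t (Suc k) \<omega>))) < \<infinity>) = 1"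
    by (rule prob_Collect_eq_1[symmetric]) measurable
  finally show ?thesis .
qed

end

theorem proposition2:
  fixes M :: "'a measure"
    and s t :: "int \<Rightarrow> 'a \<Rightarrow> real"
  assumes "prob_space M"
    and "\<And>j. s j \<in> borel_measurable M"
    and "\<And>j. t j \<in> borel_measurable M"
    and "\<And>j \<omega>. \<omega> \<in> space M \<Longrightarrow> 0 < s j \<omega>"
    and "\<And>j \<omega>. \<omega> \<in> space M \<Longrightarrow> 0 < t j \<omega>"
  shows
    "(assumption_A1 M s t \<and> (\<integral>\<^sup>+ \<omega>. ennreal (t 1 \<omega>) \<partial>M) < \<infinity> \<and> (\<integral>\<^sup>+ \<omega>. ennreal (s 1 \<omega>) \<partial>M) < \<infinity>
        \<longrightarrow> (AE \<omega> in M. X_tilde_inf s t \<omega> < \<infinity>)) \<and>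
     (assumption_A2 M s t \<and> (\<integral>\<^sup>+ \<omega>. ennreal (t 1 \<omega>) \<partial>M) < \<infinity> \<and> (AE \<omega> in M. X_tilde_inf s t \<omega> < \<infinity>)
        \<longrightarrow> (\<integral>\<^sup>+ \<omega>. ennreal (s 1 \<omega>) \<partial>M) < \<infinity>) \<and>
     (assumption_A2 M s t
        \<longrightarrow> ((AE \<omega> in M. X_tilde_inf s t \<omega> < \<infinity>) \<longleftrightarrow>
             \<P>(\<omega> in M. (\<Sum>k. ennreal (tail_prob M (s 1) (T_tilde t (Suc k) \<omega>))) < \<infinity>) = 1))"
proof (intro conjI impI; (elim conjE)?)
  assume "assumption_A1 M s t" "(\<integral>\<^sup>+ \<omega>. ennreal (s 1 \<omega>) \<partial>M) < \<infinity>"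
  with assms show "AE \<omega> in M. X_tilde_inf s t \<omega> < \<infinity>"
    by (intro prob_space.AE_X_tilde_inf_finite_if_A1)
next
  assume A2: "assumption_A2 M s t"
  have q: "queue_A2 M s t"
    using assms A2 by (intro queue_A2.intro queue_A2_axioms.intro)
  show "(\<integral>\<^sup>+ \<omega>. ennreal (s 1 \<omega>) \<partial>M) < \<infinity>"
    if "(\<integral>\<^sup>+ \<omega>. ennreal (t 1 \<omega>) \<partial>M) < \<infinity>" "AE \<omega> in M. X_tilde_inf s t \<omega> < \<infinity>"
    using that by (rule queue_A2.nn_integral_s_finite[OF q])
  show "(AE \<omega> in M. X_tilde_inf s t \<omega> < \<infinity>) \<longleftrightarrow>
      \<P>(\<omega> in M. (\<Sum>k. ennreal (tail_prob M (s 1) (T_tilde t (Suc k) \<omega>))) < \<infinity>) = 1"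
    by (rule queue_A2.AE_X_tilde_inf_finite_iff_prob[OF q])
qed

end
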